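(* Let $0<\gamma<n$, let $u\in A_1$ be a weight on $\mathbb{R}^n$, let $v(x)=|x|^\beta$ with $\beta<-n$, and let $q=n/(n-\gamma)$. Then there exists a positive constant $C$ such that the inequality \[uv^q\left(\left\{x\in\mathbb{R}^n: \frac{M_\gamma(fv)(x)}{v(x)}>t\right\}\right)^{1/q}\leq \frac{C}{t}\int_{\mathbb{R}^n}|f(x)|\,u^{1/q}(x)\,v(x)\,dx\] holds for every $t>0$ and every bounded (measurable) function $f$ on $\mathbb{R}^n$.
   Context: A weight is a locally integrable function $w$ on $\mathbb{R}^n$ with $0<w(x)<\infty$ for almost every $x$. For a nonnegative measurable function $w$ and a measurable set $E$, $w(E)=\int_E w(x)\,dx$; thus $uv^q(E)=\int_E u(x)v(x)^q\,dx$. Cubes have sides parallel to the coordinate axes. A weight $w$ belongs to $A_1$ if there is a constant $C>0$ with $\frac1{|Q|}\int_Q w\leq C\inf_Q w$ (essential infimum) for every cube $Q\subseteq\mathbb{R}^n$. The fractional maximal operator is $M_\gamma f(x)=\sup_{Q\ni x}|Q|^{\gamma/n}\frac{1}{|Q|}\int_Q|f(y)|\,dy$, the supremum over all cubes $Q$ containing $x$. *)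

theory Defs
  imports "HOL-Analysis.Analysis"
begin

definition cubes :: "(real ^ 'n) set set" where
  "cubes = {cbox a (\<chi> i. a $ i + l) | a l. l > 0}"

definition locally_integrable :: "(real ^ 'n \<Rightarrow> real) \<Rightarrow> bool" where
  "locally_integrable w \<longleftrightarrow> w \<in> borel_measurable lebesgue \<and>
     (\<forall>K. compact K \<longrightarrow> set_integrable lebesgue K w)"

text \<open>Weights are real-valued, so the requirement that they be finite almost everywhere is
  automatic. Values on the null set where a weight fails to be positive are irrelevant below.\<close>

definition weight :: "(real ^ 'n \<Rightarrow> real) \<Rightarrow> bool" where
  "weight w \<longleftrightarrow> locally_integrable w \<and> (AE x in lebesgue. 0 < w x)"

definition weighted_measure :: "(real ^ 'n \<Rightarrow> real) \<Rightarrow> (real ^ 'n) set \<Rightarrow> ennreal" where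
  "weighted_measure w E = (\<integral>\<^sup>+x\<in>E. ennreal (w x) \<partial>lebesgue)"

definition essinf_on :: "(real ^ 'n) set \<Rightarrow> (real ^ 'n \<Rightarrow> ennreal) \<Rightarrow> ennreal" where
  "essinf_on E g = Sup {c. AE x in lebesgue. x \<in> E \<longrightarrow> c \<le> g x}"

definition A1_weight :: "(real ^ 'n \<Rightarrow> real) \<Rightarrow> bool" where
  "A1_weight w \<longleftrightarrow> weight w \<and>
     (\<exists>C>0. \<forall>Q\<in>cubes. ennreal (1 / measure lebesgue Q) * weighted_measure w Q
                     \<le> ennreal C * essinf_on Q (\<lambda>x. ennreal (w x)))"

text \<open>Formed with nonnegative integrals, so that it is defined, with values in \<open>[0, \<infinity>]\<close>, also for
  functions that are not locally integrable.\<close>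

definition fractional_maximal :: "real \<Rightarrow> (real ^ 'n \<Rightarrow> real) \<Rightarrow> real ^ 'n \<Rightarrow> ennreal" where
  "fractional_maximal \<gamma> f x =
     (SUP Q\<in>{Q \<in> cubes. x \<in> Q}.
        ennreal (measure lebesgue Q powr (\<gamma> / real CARD('n))) *
        (ennreal (1 / measure lebesgue Q) * (\<integral>\<^sup>+y\<in>Q. ennreal \<bar>f y\<bar> \<partial>lebesgue)))"

text \<open>Powers of elements of \<open>[0, \<infinity>]\<close>, intended for positive exponents only.\<close>

definition ennreal_powr :: "ennreal \<Rightarrow> real \<Rightarrow> ennreal" where
  "ennreal_powr x p = (if x = top then top else ennreal (enn2real x powr p))"

end

theory Submission
  imports Defs
begin

text \<open>Write \<open>g = |f| v\<close>, \<open>p = 1 / q\<close> and \<open>I = \<integral> g u\<^sup>p\<close>. The \<open>A\<^sub>1\<close> condition gives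
  \<open>u(P) \<le> C |P| u(y)\<close> for almost every \<open>y\<close> in a cube \<open>P\<close>, so a cube \<open>Q\<close> through \<open>x\<close>, of side \<open>l\<close>,
  witnessing \<open>M(fv)(x) > t v(x)\<close> yields \<open>t v(x) u(P)\<^sup>p \<le> K \<integral>\<^bsub>Q\<^esub> g u\<^sup>p\<close> for every cube \<open>P\<close> that contains
  \<open>Q\<close> and has comparable size. If \<open>l\<close> is small relative to \<open>|x|\<close>, then \<open>v\<close> is comparable to \<open>v(x)\<close>
  near \<open>Q\<close>, and the Vitali covering lemma together with \<open>q \<ge> 1\<close> bounds the contribution of all such
  \<open>x\<close>. If \<open>l\<close> is not small, take for \<open>P\<close> a cube centred at the origin: with
  \<open>\<phi>(r) = r powr (\<beta> q) * u([-r, r]\<^sup>n)\<close> this gives \<open>\<phi>(|x|) \<le> K (I / t)\<^sup>q\<close>. Since \<open>\<beta> q < - n\<close>,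
  \<open>\<phi>(r)\<close> dominates the measure of \<open>{|x| \<ge> r}\<close> by a geometric series over dyadic annuli, and letting \<open>r\<close>
  decrease to the infimum of the admissible \<open>|x|\<close> finishes the proof.\<close>

section \<open>Coordinate cubes and their weighted measures\<close>

definition centered_cube :: "real ^ 'n \<Rightarrow> real \<Rightarrow> (real ^ 'n) set" where
  "centered_cube a r = cbox (\<chi> i. a $ i - r) (\<chi> i. a $ i + r)"

lemma mem_centered_cube: "y \<in> centered_cube a r \<longleftrightarrow> (\<forall>i. \<bar>y $ i - a $ i\<bar> \<le> r)"
  by (simp add: centered_cube_def mem_box_cart abs_le_iff algebra_simps) (meson order_trans)

lemma measure_cube:
  fixes a :: "real ^ 'n"
  assumes "0 < l"
  shows "measure lebesgue (cbox a (\<chi> i. a $ i + l)) = l ^ CARD('n)"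
proof -
  have "cbox a (\<chi> i. a $ i + l) \<noteq> {}"
    using assms by (simp add: interval_ne_empty_cart)
  then have "measure lborel (cbox a (\<chi> i. a $ i + l)) = l ^ CARD('n)"
    by (simp add: content_cbox_cart)
  then show ?thesis by (simp add: measure_completion)
qed

lemma centered_cube_eq:
  "centered_cube a r = cbox (\<chi> i. a $ i - r) (\<chi> i. (\<chi> i. a $ i - r) $ i + 2 * r)"
  by (simp add: centered_cube_def algebra_simps)

lemma centered_cube_in_cubes: "0 < r \<Longrightarrow> centered_cube a r \<in> cubes"
  unfolding cubes_def using centered_cube_eq[of a r]
  by (intro CollectI exI[of _ "\<chi> i. a $ i - r"] exI[of _ "2 * r"]) simp

lemma measure_centered_cube:
  "0 < r \<Longrightarrow> measure lebesgue (centered_cube (a :: real ^ 'n) r) = (2 * r) ^ CARD('n)"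
  unfolding centered_cube_eq by (subst measure_cube) auto

lemma cubes_lebesgue: "Q \<in> cubes \<Longrightarrow> Q \<in> sets lebesgue"
  by (auto simp: cubes_def)

lemma measure_cubes_pos:
  fixes Q :: "(real ^ 'n) set"
  assumes "Q \<in> cubes"
  shows "0 < measure lebesgue Q"
proof -
  obtain a l where "Q = cbox a (\<chi> i. a $ i + l)" "l > 0" using assms by (auto simp: cubes_def)
  then show ?thesis by (simp only: measure_cube) simp
qed

lemma weighted_measure_mono: "A \<subseteq> B \<Longrightarrow> weighted_measure w A \<le> weighted_measure w B"
  unfolding weighted_measure_def by (intro nn_integral_mono) (auto simp: indicator_def)

lemma weighted_measure_cube_finite:
  assumes "weight u" "Q \<in> cubes"
  shows "weighted_measure u Q < top"
proof -
  have "compact Q" using assms(2) by (auto simp: cubes_def)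
  then have "set_integrable lebesgue Q u"
    using assms(1) by (auto simp: weight_def locally_integrable_def)
  then have "(\<integral>\<^sup>+x. ennreal (norm (indicator Q x *\<^sub>R u x)) \<partial>lebesgue) < top"
    unfolding set_integrable_def integrable_iff_bounded by (simp add: top.not_eq_extremum)
  moreover have "weighted_measure u Q \<le> (\<integral>\<^sup>+x. ennreal (norm (indicator Q x *\<^sub>R u x)) \<partial>lebesgue)"
    unfolding weighted_measure_def
    by (intro nn_integral_mono) (auto simp: indicator_def intro!: ennreal_leI)
  ultimately show ?thesis by (rule le_less_trans[rotated])
qed

section \<open>Almost-everywhere consequences of the A_1 condition\<close>

text \<open>The supremum in \<open>essinf_on\<close> is reached along a sequence of a.e. lower
  bounds, and the union of countably many null sets is null.\<close>

lemma essinf_on_le: "AE x in lebesgue. x \<in> E \<longrightarrow> essinf_on E g \<le> g x"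
proof -
  let ?A = "{c. AE x in lebesgue. x \<in> E \<longrightarrow> c \<le> g x}"
  have "0 \<in> ?A" by simp
  then obtain f :: "nat \<Rightarrow> ennreal" where f: "range f \<subseteq> ?A" "Sup ?A = (SUP i. f i)"
    using ennreal_Sup_countable_SUP[of ?A] by blast
  have "AE x in lebesgue. \<forall>i. x \<in> E \<longrightarrow> f i \<le> g x"
    using f(1) by (subst AE_all_countable) blast
  then show ?thesis unfolding essinf_on_def f(2) by eventually_elim (auto intro: SUP_least)
qed

text \<open>The essential infimum is replaced by the value at almost every point, and the average is
  cleared of its denominator. \<open>enn2real\<close> loses nothing, because local integrability
  makes the weighted measure of a cube finite.\<close>

lemma A1_weight_AE:
  assumes "A1_weight u"
  obtains C where "C > 0"
    "\<And>Q. Q \<in> cubes \<Longrightarrow> AE x in lebesgue. x \<in> Q \<longrightarrow>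
       enn2real (weighted_measure u Q) \<le> C * measure lebesgue Q * u x"
proof -
  from assms obtain C where C: "C > 0" "\<And>Q. Q \<in> cubes \<Longrightarrow>
      ennreal (1 / measure lebesgue Q) * weighted_measure u Q
        \<le> ennreal C * essinf_on Q (\<lambda>x. ennreal (u x))"
    and w: "weight u" by (auto simp: A1_weight_def)
  show thesis
  proof (rule that[OF C(1)])
    fix Q :: "(real ^ 'a) set" assume Q: "Q \<in> cubes"
    define U where "U = enn2real (weighted_measure u Q)"
    have U: "weighted_measure u Q = ennreal U" "U \<ge> 0"
      using weighted_measure_cube_finite[OF w Q] by (auto simp: U_def)
    have m: "0 < measure lebesgue Q" by (rule measure_cubes_pos[OF Q])
    have "AE x in lebesgue. 0 < u x" using w by (simp add: weight_def)
    with essinf_on_le[of Q "\<lambda>x. ennreal (u x)"]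
    show "AE x in lebesgue. x \<in> Q \<longrightarrow> enn2real (weighted_measure u Q) \<le> C * measure lebesgue Q * u x"
    proof eventually_elim
      case (elim x)
      show ?case
      proof
        assume "x \<in> Q"
        then have "ennreal (1 / measure lebesgue Q) * ennreal U \<le> ennreal C * ennreal (u x)"
          using C(2)[OF Q] elim U(1) by (metis mult_left_mono order_trans zero_le)
        then have "1 / measure lebesgue Q * U \<le> C * u x"
          using U(2) m C(1) elim by (simp add: ennreal_mult[symmetric] del: times_divide_eq_left)
        then show "enn2real (weighted_measure u Q) \<le> C * measure lebesgue Q * u x"
          using m by (simp add: U_def field_simps)
      qed
    qed
  qed
qed

text \<open>In use, \<open>U\<close> is the \<open>u\<close>-measure of the enlarged cube
  \<open>P\<close>. Since \<open>P\<close> is at most \<open>\<kappa>\<close> times as large as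
  \<open>Q\<close>, the A_1 bound gives \<open>?c \<le> u y powr p\<close> almost everywhere on
  \<open>Q\<close>. Under the integral of \<open>g\<close>, this trades the volume factor for the
  weight \<open>u powr p\<close>.\<close>

lemma weighted_maximal_bound:
  fixes u g :: "real ^ 'n \<Rightarrow> real"
  assumes pos: "AE x in lebesgue. 0 < u x"
    and u: "u \<in> borel_measurable lebesgue" and g: "g \<in> borel_measurable lebesgue" "\<And>x. 0 \<le> g x"
    and A1: "AE x in lebesgue. x \<in> P \<longrightarrow> U \<le> C * measure lebesgue P * u x"
    and C: "0 < C" "0 \<le> U" "0 < \<kappa>" "0 < p" "0 \<le> s"
    and Q: "Q \<in> cubes" "Q \<subseteq> P" "measure lebesgue P \<le> \<kappa> * measure lebesgue Q"
    and s: "ennreal s \<le> ennreal (measure lebesgue Q powr - p) * weighted_measure g Q"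
  shows "ennreal (s * (U / (C * \<kappa>)) powr p) \<le> weighted_measure (\<lambda>y. g y * u y powr p) Q"
proof -
  have m: "0 < measure lebesgue Q" by (rule measure_cubes_pos[OF Q(1)])
  let ?c = "(U / (C * \<kappa>)) powr p * measure lebesgue Q powr - p"
  have "ennreal (s * (U / (C * \<kappa>)) powr p) = ennreal ((U / (C * \<kappa>)) powr p) * ennreal s"
    using C by (simp add: ennreal_mult' mult.commute)
  also have "\<dots> \<le> ennreal ((U / (C * \<kappa>)) powr p) *
      (ennreal (measure lebesgue Q powr - p) * weighted_measure g Q)"
    by (intro mult_left_mono s) auto
  also have "\<dots> = (\<integral>\<^sup>+y. ennreal ?c * (ennreal (g y) * indicator Q y) \<partial>lebesgue)"
    unfolding weighted_measure_def using g cubes_lebesgue[OF Q(1)]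
    by (subst nn_integral_cmult) (auto simp: ennreal_mult' mult.assoc)
  also have "\<dots> \<le> weighted_measure (\<lambda>y. g y * u y powr p) Q"
    unfolding weighted_measure_def
  proof (rule nn_integral_mono_AE)
    show "AE y in lebesgue. ennreal ?c * (ennreal (g y) * indicator Q y)
        \<le> ennreal (g y * u y powr p) * indicator Q y"
      using pos A1
    proof eventually_elim
      case (elim y)
      show ?case
      proof (cases "y \<in> Q")
        case True
        have "U \<le> C * measure lebesgue P * u y" using elim True Q(2) by auto
        also have "\<dots> \<le> C * (\<kappa> * measure lebesgue Q) * u y"
          using elim C Q(3) by (intro mult_right_mono mult_left_mono) auto
        finally have "U / (C * \<kappa>) \<le> measure lebesgue Q * u y"
          using C by (simp add: field_simps)
        then have "(U / (C * \<kappa>)) powr p \<le> (measure lebesgue Q * u y) powr p"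
          using C by (intro powr_mono2) auto
        then have "?c \<le> (measure lebesgue Q * u y) powr p * measure lebesgue Q powr - p"
          by (intro mult_right_mono) auto
        also have "\<dots> = u y powr p"
          using m elim by (simp add: powr_mult powr_minus field_simps)
        finally show ?thesis
          using True g(2)[of y]
          by (auto simp: ennreal_mult'[symmetric] mult.commute intro!: ennreal_leI mult_left_mono)
      qed simp
    qed
  qed
  finally show ?thesis .
qed

section \<open>The weighted measure as a set function\<close>

lemma weighted_measure_eq_emeasure:
  assumes "w \<in> borel_measurable lebesgue" "A \<in> sets lebesgue"
  shows "weighted_measure w A = emeasure (density lebesgue (\<lambda>x. ennreal (w x))) A"
  using assms by (simp add: weighted_measure_def emeasure_density)

text \<open>Integration over \<open>count_space I\<close> serves as a sum over any countable index
  set, such as the centres selected by a covering lemma.\<close>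

lemma weighted_measure_UN_le:
  fixes A :: "'i \<Rightarrow> (real ^ 'n) set"
  assumes w: "w \<in> borel_measurable lebesgue" and I: "countable I"
    and A: "\<And>i. i \<in> I \<Longrightarrow> A i \<in> sets lebesgue"
  shows "weighted_measure w (\<Union>i\<in>I. A i) \<le> (\<integral>\<^sup>+i. weighted_measure w (A i) \<partial>count_space I)"
proof -
  have "weighted_measure w (\<Union>i\<in>I. A i)
      \<le> (\<integral>\<^sup>+x. (\<integral>\<^sup>+i. ennreal (w x) * indicator (A i) x \<partial>count_space I) \<partial>lebesgue)"
    unfolding weighted_measure_def
  proof (intro nn_integral_mono)
    fix x :: "real ^ 'n"
    show "ennreal (w x) * indicator (\<Union>i\<in>I. A i) x
        \<le> (\<integral>\<^sup>+i. ennreal (w x) * indicator (A i) x \<partial>count_space I)"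
    proof (cases "x \<in> (\<Union>i\<in>I. A i)")
      case True
      then obtain i where i: "i \<in> I" "x \<in> A i" by auto
      with nn_integral_ge_point[OF i(1), of "\<lambda>i. ennreal (w x) * indicator (A i) x"] True
      show ?thesis by simp
    qed simp
  qed
  also have "\<dots> = (\<integral>\<^sup>+i. weighted_measure w (A i) \<partial>count_space I)"
    unfolding weighted_measure_def
    using w A by (intro nn_integral_count_space_nn_integral I) auto
  finally show ?thesis .
qed

lemma sum_weighted_measure_disjoint_le:
  fixes A :: "'i \<Rightarrow> (real ^ 'n) set"
  assumes w: "w \<in> borel_measurable lebesgue" and I: "countable I"
    and A: "\<And>i. i \<in> I \<Longrightarrow> A i \<in> sets lebesgue" and d: "disjoint_family_on A I"
  shows "(\<integral>\<^sup>+i. weighted_measure w (A i) \<partial>count_space I) \<le> (\<integral>\<^sup>+x. ennreal (w x) \<partial>lebesgue)"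
proof -
  let ?N = "density lebesgue (\<lambda>x. ennreal (w x))"
  have "(\<integral>\<^sup>+i. weighted_measure w (A i) \<partial>count_space I) = (\<integral>\<^sup>+i. emeasure ?N (A i) \<partial>count_space I)"
    using A by (intro nn_integral_cong) (simp add: weighted_measure_eq_emeasure[OF w])
  also have "\<dots> = emeasure ?N (\<Union>i\<in>I. A i)"
    using A by (intro emeasure_UN_countable[symmetric] I d) auto
  also have "\<dots> \<le> emeasure ?N (space ?N)" by (rule emeasure_space)
  also have "\<dots> = (\<integral>\<^sup>+x. ennreal (w x) \<partial>lebesgue)"
    using w emeasure_density[of "\<lambda>x. ennreal (w x)" lebesgue UNIV] by simp
  finally show ?thesis .
qed

text \<open>No measurability of \<open>A N\<close> is known, so continuity from below is applied to
  \<open>H N\<close>, the intersection of all covers from index \<open>N\<close> on. It is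
  measurable, increases with \<open>N\<close>, and contains \<open>A N\<close> because
  \<open>A\<close> increases.\<close>

lemma weighted_measure_UN_incseq_le:
  fixes A B :: "nat \<Rightarrow> (real ^ 'n) set"
  assumes w: "w \<in> borel_measurable lebesgue" and inc: "incseq A" and AB: "\<And>N. A N \<subseteq> B N"
    and B: "\<And>N. B N \<in> sets lebesgue" "\<And>N. weighted_measure w (B N) \<le> c"
  shows "weighted_measure w (\<Union>N. A N) \<le> c"
proof -
  let ?N = "density lebesgue (\<lambda>x. ennreal (w x))"
  define H where "H N = (\<Inter>m\<in>{N..}. B m)" for N
  have H: "H N \<in> sets lebesgue" for N
    unfolding H_def using B(1) by (intro sets.countable_INT'') auto
  have "A N \<subseteq> H N" for N
    using inc AB by (auto simp: H_def incseq_def) blast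
  then have "weighted_measure w (\<Union>N. A N) \<le> weighted_measure w (\<Union>N. H N)"
    by (intro weighted_measure_mono) blast
  also have "\<dots> = emeasure ?N (\<Union>N. H N)"
    using H by (intro weighted_measure_eq_emeasure w) auto
  also have "\<dots> = (SUP N. emeasure ?N (H N))"
    using H by (intro SUP_emeasure_incseq[symmetric]) (auto simp: H_def incseq_def)
  also have "\<dots> \<le> c"
  proof (rule SUP_least)
    fix N
    have "emeasure ?N (H N) = weighted_measure w (H N)"
      by (rule weighted_measure_eq_emeasure[OF w H, symmetric])
    also have "\<dots> \<le> weighted_measure w (B N)"
      by (rule weighted_measure_mono) (auto simp: H_def)
    finally show "emeasure ?N (H N) \<le> c" using B(2)[of N] by (rule order_trans)
  qed
  finally show ?thesis .
qed

lemma weighted_measure_mult_le: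
  fixes u h :: "real ^ 'n \<Rightarrow> real"
  assumes u: "u \<in> borel_measurable lebesgue" and A: "A \<in> sets lebesgue"
    and h: "\<And>x. x \<in> A \<Longrightarrow> 0 \<le> h x \<and> h x \<le> c"
  shows "weighted_measure (\<lambda>x. u x * h x) A \<le> ennreal c * weighted_measure u A"
proof -
  have "weighted_measure (\<lambda>x. u x * h x) A
      \<le> (\<integral>\<^sup>+x. ennreal c * (ennreal (u x) * indicator A x) \<partial>lebesgue)"
    unfolding weighted_measure_def
  proof (rule nn_integral_mono)
    fix x
    show "ennreal (u x * h x) * indicator A x \<le> ennreal c * (ennreal (u x) * indicator A x)"
    proof (cases "x \<in> A")
      case True
      then have "ennreal (u x * h x) = ennreal (h x) * ennreal (u x)"
        using h by (subst mult.commute) (simp add: ennreal_mult')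
      also have "\<dots> \<le> ennreal c * ennreal (u x)"
        using True h by (intro mult_right_mono ennreal_leI) auto
      finally show ?thesis using True by simp
    qed simp
  qed
  also have "\<dots> = ennreal c * weighted_measure u A"
    unfolding weighted_measure_def using u A by (intro nn_integral_cmult) auto
  finally show ?thesis .
qed

section \<open>Elementary estimates on real numbers\<close>

text \<open>The least \<open>j\<close> satisfying the upper bound works: minimality gives the lower
  bound, except for \<open>j = 0\<close>, where it is the assumption
  \<open>s \<le> y\<close>.\<close>

lemma dyadic_annulus:
  fixes s y :: real
  assumes "0 < s" "s \<le> y"
  obtains j :: nat where "2 ^ j * s \<le> y" "y \<le> 2 ^ (j + 1) * s"
proof -
  let ?P = "\<lambda>j::nat. y \<le> 2 ^ (j + 1) * s"
  obtain m where "y / s < 2 ^ m" using real_arch_pow[of 2] by auto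
  then have "y < 2 ^ m * s" using assms by (simp add: field_simps)
  also have "\<dots> \<le> 2 ^ (m + 1) * s" using assms by simp
  finally have "?P m" by simp
  then have P: "?P (LEAST j. ?P j)" by (rule LeastI)
  have "2 ^ (LEAST j. ?P j) * s \<le> y"
  proof (cases "LEAST j. ?P j")
    case 0
    then show ?thesis using assms by simp
  next
    case (Suc k)
    then have "\<not> ?P k" by (intro not_less_Least) simp
    then show ?thesis unfolding Suc by simp
  qed
  with P show thesis by (rule that[rotated])
qed

text \<open>Raising to the power \<open>q\<close> undoes the exponent \<open>p\<close>, so that a
  bound on \<open>z powr p\<close> becomes one that is linear in \<open>z\<close>.\<close>

lemma powr_solve:
  fixes t m z J p q :: real
  assumes "0 < t" "0 \<le> m" "0 \<le> z" "0 < q" "p * q = 1" "t * m * z powr p \<le> J"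
  shows "m powr q * z \<le> (J / t) powr q"
proof -
  have "(m * z powr p) powr q \<le> (J / t) powr q"
    using assms by (intro powr_mono2) (auto simp: field_simps)
  moreover have "(m * z powr p) powr q = m powr q * z"
    using assms by (simp add: powr_mult powr_powr)
  ultimately show ?thesis by simp
qed

section \<open>Growth of an A_1 weight on cubes centred at the origin\<close>

text \<open>One \<open>C\<close> serves all cubes, so the constants below can be expressed through
  \<open>C\<close>, the dimension and the exponents.\<close>

locale A1_bound =
  fixes u :: "real ^ 'n \<Rightarrow> real" and C :: real
  assumes weight: "weight u" and C_pos: "0 < C"
    and cube_average_le: "\<And>Q. Q \<in> cubes \<Longrightarrow> AE x in lebesgue. x \<in> Q \<longrightarrow>
       enn2real (weighted_measure u Q) \<le> C * measure lebesgue Q * u x"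
begin

lemma u_measurable [measurable]: "u \<in> borel_measurable lebesgue"
  and u_pos: "AE x in lebesgue. 0 < u x"
  using weight by (auto simp: weight_def locally_integrable_def)

lemma weighted_power_measurable:
  "(\<lambda>x. u x * norm x powr a) \<in> borel_measurable lebesgue"
  by (intro borel_measurable_times u_measurable measurable_completion) simp

definition mass :: "real \<Rightarrow> real" where
  "mass r = enn2real (weighted_measure u (centered_cube 0 r))"

lemma weighted_measure_cube_eq:
  "Q \<in> cubes \<Longrightarrow> weighted_measure u Q = ennreal (enn2real (weighted_measure u Q))"
  using weighted_measure_cube_finite[OF weight] by simp

lemma mass_nonneg: "0 \<le> mass r"
  by (simp add: mass_def)

lemma mass_mono:
  assumes "0 < r" "r \<le> s"
  shows "mass r \<le> mass s"
  unfolding mass_def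
proof (rule enn2real_mono)
  show "weighted_measure u (centered_cube 0 r) \<le> weighted_measure u (centered_cube 0 s)"
    using order_trans[OF _ assms(2)]
    by (intro weighted_measure_mono) (auto simp only: mem_centered_cube)
  show "weighted_measure u (centered_cube 0 s) < top"
    using assms by (intro weighted_measure_cube_finite weight centered_cube_in_cubes) auto
qed

text \<open>The A_1 bound on the larger cube keeps \<open>u\<close> above \<open>?c\<close> almost
  everywhere on the smaller one. Integrating over the smaller cube, of volume
  \<open>(2 * s) ^ CARD('n)\<close>, gives the claim.\<close>

lemma mass_doubling:
  assumes "0 < s" "s \<le> r"
  shows "mass r \<le> C * (r / s) ^ CARD('n) * mass s"
proof -
  let ?S = "centered_cube (0 :: real ^ 'n) s" and ?R = "centered_cube (0 :: real ^ 'n) r"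
  let ?c = "mass r / (C * (2 * r) ^ CARD('n))"
  have S: "?S \<in> cubes" and R: "?R \<in> cubes"
    using assms by (auto intro: centered_cube_in_cubes)
  have c: "?c \<ge> 0" using mass_nonneg C_pos assms by simp
  have "compact ?S" by (simp add: centered_cube_def)
  then have "emeasure lebesgue ?S = ennreal ((2 * s) ^ CARD('n))"
    using assms by (metis emeasure_eq_measure2 lmeasurable_compact measure_centered_cube)
  then have "ennreal (?c * (2 * s) ^ CARD('n)) = (\<integral>\<^sup>+x. ennreal ?c * indicator ?S x \<partial>lebesgue)"
    using c by (simp only: nn_integral_cmult_indicator[OF cubes_lebesgue[OF S]] ennreal_mult')
  also have "\<dots> \<le> weighted_measure u ?S"
    unfolding weighted_measure_def
  proof (rule nn_integral_mono_AE)
    show "AE x in lebesgue. ennreal ?c * indicator ?S x \<le> ennreal (u x) * indicator ?S x"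
      using cube_average_le[OF R]
    proof eventually_elim
      case (elim x)
      show ?case
      proof (cases "x \<in> ?S")
        case True
        then have "x \<in> ?R" using assms by (auto simp: mem_centered_cube intro: order_trans)
        then have "mass r \<le> C * (2 * r) ^ CARD('n) * u x"
          using elim assms by (simp add: mass_def measure_centered_cube)
        then have "?c \<le> u x" using C_pos assms by (simp add: field_simps)
        then show ?thesis using True by (simp add: ennreal_leI)
      qed simp
    qed
  qed
  also have "\<dots> = ennreal (mass s)"
    unfolding mass_def by (rule weighted_measure_cube_eq[OF S])
  finally have "?c * (2 * s) ^ CARD('n) \<le> mass s" using mass_nonneg by simp
  then show ?thesis
    using C_pos assms by (simp add: field_simps power_mult_distrib power_divide)
qed

text \<open>On the \<open>j\<close>-th dyadic annulus the power is at most
  \<open>(2 ^ j * s) powr a\<close>, while \<open>mass_doubling\<close> lets the mass grow only like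
  \<open>2 ^ j\<close> to the dimension. The series is therefore geometric with ratio
  \<open>\<theta>\<close>, which is below 1 because \<open>a < - real CARD('n)\<close>.\<close>

lemma tail_bound:
  assumes a: "a < - real CARD('n)"
  obtains K where "0 < K" "\<And>s. 0 < s \<Longrightarrow>
    weighted_measure (\<lambda>x. u x * norm x powr a) {x. s \<le> norm x} \<le> ennreal (K * (s powr a * mass s))"
proof -
  define \<theta> where "\<theta> = (2::real) powr (a + CARD('n))"
  have \<theta>: "0 < \<theta>" "\<theta> < 1" using a by (auto simp: \<theta>_def powr_less_one)
  \<comment> \<open>The factor \<open>2 ^ CARD('n)\<close> comes from the outer radius
    \<open>2 ^ (j + 1) * s\<close>, and \<open>1 / (1 - \<theta>)\<close> is the sum of the
    series.\<close>
  define K where "K = C * 2 ^ CARD('n) / (1 - \<theta>)"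
  show thesis
  proof (rule that)
    show "0 < K" using \<theta> C_pos by (simp add: K_def)
  next
    fix s :: real assume s: "0 < s"
    define D where "D j = {x :: real ^ 'n. 2 ^ j * s \<le> norm x \<and> norm x \<le> 2 ^ (j + 1) * s}" for j :: nat
    have "closed (D j)" for j
      unfolding D_def Collect_conj_eq by (intro closed_Int closed_Collect_le continuous_intros)
    then have Dm: "D j \<in> sets lebesgue" for j by (rule lebesgue_closedin[of UNIV, simplified])
    let ?c = "C * 2 ^ CARD('n) * (s powr a * mass s)"
    have D: "weighted_measure (\<lambda>x. u x * norm x powr a) (D j) \<le> ennreal (?c * \<theta> ^ j)" for j
    proof -
      have *: "0 < 2 ^ (j + 1) * s" using s by simp
      have "weighted_measure (\<lambda>x. u x * norm x powr a) (D j)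
          \<le> ennreal ((2 ^ j * s) powr a) * weighted_measure u (D j)"
        using s a by (intro weighted_measure_mult_le Dm) (auto simp: D_def intro!: powr_mono2')
      also have "weighted_measure u (D j) \<le> weighted_measure u (centered_cube 0 (2 ^ (j + 1) * s))"
        by (intro weighted_measure_mono)
          (auto simp: D_def mem_centered_cube intro: order_trans[OF component_le_norm_cart])
      also have "\<dots> = ennreal (mass (2 ^ (j + 1) * s))"
        unfolding mass_def by (intro weighted_measure_cube_eq centered_cube_in_cubes *)
      also have "\<dots> \<le> ennreal (C * (2 ^ (j + 1) * s / s) ^ CARD('n) * mass s)"
        using s by (intro ennreal_leI mass_doubling) (auto simp: mult_le_cancel_right1 intro: order_trans[of 1 "2 ^ j"])
      also have "ennreal ((2 ^ j * s) powr a) * \<dots> = ennreal (?c * \<theta> ^ j)"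
      proof -
        have "\<theta> ^ j = (2 ^ j) powr a * (2 ^ j) ^ CARD('n)"
          by (simp add: \<theta>_def powr_add powr_realpow[symmetric] powr_powr powr_mult mult.commute
              flip: powr_add) (simp add: algebra_simps powr_add)
        then show ?thesis using s
          by (simp add: ennreal_mult'[symmetric] powr_mult power_mult_distrib mult_ac)
      qed
      finally show ?thesis by (simp add: mult_left_mono)
    qed
    have "{x. s \<le> norm x} \<subseteq> (\<Union>j. D j)"
      unfolding D_def using dyadic_annulus[OF s] by (blast intro: UN_I)
    then have "weighted_measure (\<lambda>x. u x * norm x powr a) {x. s \<le> norm x}
        \<le> weighted_measure (\<lambda>x. u x * norm x powr a) (\<Union>j. D j)"
      by (rule weighted_measure_mono)
    also have "\<dots> \<le> (\<integral>\<^sup>+j. weighted_measure (\<lambda>x. u x * norm x powr a) (D j) \<partial>count_space UNIV)"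
      by (intro weighted_measure_UN_le Dm weighted_power_measurable) auto
    also have "\<dots> \<le> (\<integral>\<^sup>+j. ennreal (?c * \<theta> ^ j) \<partial>count_space UNIV)"
      by (intro nn_integral_mono D)
    also have "\<dots> = (\<Sum>j. ennreal (?c * \<theta> ^ j))" by (rule nn_integral_count_space_nat)
    also have "\<dots> = ennreal (\<Sum>j. ?c * \<theta> ^ j)"
      using \<theta> C_pos mass_nonneg
      by (intro suminf_ennreal2 summable_mult summable_geometric) auto
    also have "(\<Sum>j. ?c * \<theta> ^ j) = K * (s powr a * mass s)"
      using \<theta> by (subst suminf_mult) (auto simp: suminf_geometric K_def summable_geometric)
    finally show "weighted_measure (\<lambda>x. u x * norm x powr a) {x. s \<le> norm x}
        \<le> ennreal (K * (s powr a * mass s))" .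
  qed
qed

end

section \<open>Cubes compared with balls\<close>

lemma cube_dist_le:
  fixes x y a :: "real ^ 'n"
  assumes "x \<in> cbox a (\<chi> i. a $ i + l)" "y \<in> cbox a (\<chi> i. a $ i + l)"
  shows "\<bar>y $ i - x $ i\<bar> \<le> l"
proof -
  have "a $ i \<le> x $ i" "x $ i \<le> a $ i + l" "a $ i \<le> y $ i" "y $ i \<le> a $ i + l"
    using assms by (auto simp: mem_box_cart)
  then show ?thesis by linarith
qed

text \<open>The Euclidean distance is at most the sum of the coordinate differences, each at most
  \<open>l\<close>. This radius is crude, but the covering argument only needs some fixed multiple
  of \<open>l\<close>.\<close>

lemma cube_subset_cball:
  fixes x a :: "real ^ 'n"
  assumes "x \<in> cbox a (\<chi> i. a $ i + l)"
  shows "cbox a (\<chi> i. a $ i + l) \<subseteq> cball x (real CARD('n) * l)"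
proof
  fix y assume y: "y \<in> cbox a (\<chi> i. a $ i + l)"
  have "dist x y \<le> (\<Sum>i\<in>UNIV. \<bar>(y - x) $ i\<bar>)"
    unfolding dist_norm norm_minus_commute[of x] by (rule norm_le_l1_cart)
  also have "\<dots> \<le> (\<Sum>i\<in>(UNIV :: 'n set). l)"
    using cube_dist_le[OF assms y] by (intro sum_mono) simp
  finally show "y \<in> cball x (real CARD('n) * l)" by simp
qed

section \<open>Estimates from a single witnessing cube\<close>

context A1_bound
begin

text \<open>As \<open>norm x \<le> l / c\<close>, the origin-centred cube of half-side
  \<open>norm x + l\<close> contains \<open>Q\<close> and exceeds it in volume by a constant factor
  only. Passing from \<open>mass ?L\<close> down to \<open>mass (norm x)\<close> then removes
  \<open>l\<close> from the bound.\<close>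

lemma large_cube_bound:
  fixes g :: "real ^ 'n \<Rightarrow> real"
  assumes g: "g \<in> borel_measurable lebesgue" "\<And>x. 0 \<le> g x"
    and par: "0 < t" "0 < p" "p * q = 1" "0 < c" "0 \<le> I"
    and Q: "Q = cbox a (\<chi> i. a $ i + l)" "0 < l" "x \<in> Q" "x \<noteq> 0" "c * norm x \<le> l"
    and s: "ennreal (t * norm x powr b) \<le> ennreal (measure lebesgue Q powr - p) * weighted_measure g Q"
    and I: "weighted_measure (\<lambda>y. g y * u y powr p) Q \<le> ennreal I"
  shows "norm x powr (b * q) * mass (norm x) \<le> C * (2 * (1 / c + 1)) ^ CARD('n) * (I / t) powr q"
proof -
  let ?L = "norm x + l" and ?\<kappa> = "(2 * (1 / c + 1)) ^ CARD('n)"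
  let ?P = "centered_cube (0 :: real ^ 'n) ?L"
  have q: "0 < q" using par by (metis zero_less_mult_pos zero_less_one)
  have c: "0 < 2 * (1 / c + 1)" using par by (simp add: add_pos_pos)
  have Qc: "Q \<in> cubes" using Q by (auto simp: cubes_def)
  have P: "?P \<in> cubes" using Q by (intro centered_cube_in_cubes) (simp add: add_nonneg_pos)
  have sub: "Q \<subseteq> ?P"
  proof
    fix y assume "y \<in> Q"
    then have "\<bar>y $ i - x $ i\<bar> \<le> l" for i using Q cube_dist_le by blast
    moreover have "\<bar>y $ i\<bar> \<le> \<bar>x $ i\<bar> + \<bar>y $ i - x $ i\<bar>" for i by linarith
    ultimately have "\<bar>y $ i\<bar> \<le> norm x + l" for i
      using component_le_norm_cart[of x i] by (meson add_mono order_trans)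
    then show "y \<in> ?P" by (simp add: mem_centered_cube)
  qed
  have "?L \<le> (1 / c + 1) * l" using Q par by (simp add: field_simps)
  then have "2 * ?L \<le> 2 * (1 / c + 1) * l" using mult_left_mono[of _ _ 2] by (simp only: mult.assoc) simp
  then have "(2 * ?L) ^ CARD('n) \<le> (2 * (1 / c + 1) * l) ^ CARD('n)"
    using Q by (intro power_mono) auto
  then have \<kappa>: "measure lebesgue ?P \<le> ?\<kappa> * measure lebesgue Q"
    using Q by (simp only: Q(1) measure_cube) (simp add: measure_centered_cube add_nonneg_pos power_mult_distrib)
  have "ennreal (t * norm x powr b * (mass ?L / (C * ?\<kappa>)) powr p)
      \<le> weighted_measure (\<lambda>y. g y * u y powr p) Q"
    unfolding mass_def using par C_pos s zero_less_power[OF c, of "CARD('n)"]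
    by (intro weighted_maximal_bound[OF u_pos u_measurable g cube_average_le[OF P] _ _ _ _ _ Qc sub \<kappa>]) auto
  also note I
  finally have "t * norm x powr b * (mass ?L / (C * ?\<kappa>)) powr p \<le> I"
    using par by simp
  then have "(norm x powr b) powr q * (mass ?L / (C * ?\<kappa>)) \<le> (I / t) powr q"
    using par q C_pos mass_nonneg by (intro powr_solve) auto
  then have "norm x powr (b * q) * mass ?L \<le> C * ?\<kappa> * (I / t) powr q"
    using pos_divide_le_eq[OF mult_pos_pos[OF C_pos zero_less_power[OF c, of "CARD('n)"]]]
    by (simp add: powr_powr mult.commute)
  moreover have "norm x powr (b * q) * mass (norm x) \<le> norm x powr (b * q) * mass ?L"
    using Q by (intro mult_left_mono mass_mono) auto
  ultimately show ?thesis by simp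
qed

text \<open>The ball is five times the one containing \<open>Q\<close> that enters the Vitali
  covering. By the bound on \<open>l\<close> it stays at distance at least \<open>norm x / 2\<close>
  from the origin, so the power weight there is at most \<open>2 powr - (b * q)\<close> times its
  value at \<open>x\<close>.\<close>

lemma small_cube_bound:
  fixes g :: "real ^ 'n \<Rightarrow> real"
  assumes g: "g \<in> borel_measurable lebesgue" "\<And>x. 0 \<le> g x"
    and par: "0 < t" "0 < p" "p * q = 1" "1 \<le> q" "b < 0" "0 \<le> I"
    and Q: "Q = cbox a (\<chi> i. a $ i + l)" "0 < l" "x \<in> Q" "10 * real CARD('n) * l \<le> norm x"
    and s: "ennreal (t * norm x powr b) \<le> ennreal (measure lebesgue Q powr - p) * weighted_measure g Q"
    and I: "weighted_measure (\<lambda>y. g y * u y powr p) Q \<le> ennreal I"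
  shows "weighted_measure (\<lambda>y. u y * norm y powr (b * q)) (cball x (5 * (real CARD('n) * l)))
    \<le> ennreal (2 powr - (b * q) * (C * (10 * real CARD('n)) ^ CARD('n)) * (I powr (q - 1) / t powr q)) *
      weighted_measure (\<lambda>y. g y * u y powr p) Q"
proof -
  let ?r = "5 * (real CARD('n) * l)" and ?\<kappa> = "(10 * real CARD('n)) ^ CARD('n)"
  let ?P = "centered_cube x ?r"
  define U where "U = enn2real (weighted_measure u ?P)"
  define J where "J = enn2real (weighted_measure (\<lambda>y. g y * u y powr p) Q)"
  have n: "1 \<le> real CARD('n)" by (simp add: Suc_le_eq)
  have r: "0 < ?r" "l \<le> ?r" "?r \<le> norm x / 2" and x: "0 < norm x"
    using Q(2,4) mult_right_mono[OF n, of l] by linarith+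
  have J: "weighted_measure (\<lambda>y. g y * u y powr p) Q = ennreal J" "0 \<le> J" "J \<le> I"
    using I par by (auto simp: J_def enn2real_leI intro!: ennreal_enn2real[symmetric] le_less_trans[OF I])
  have Qc: "Q \<in> cubes" using Q by (auto simp: cubes_def)
  have P: "?P \<in> cubes" using r by (intro centered_cube_in_cubes)
  have sub: "Q \<subseteq> ?P"
    unfolding Q(1) using order_trans[OF cube_dist_le[OF Q(3)[unfolded Q(1)]] r(2)]
    by (auto simp only: mem_centered_cube)
  have \<kappa>: "measure lebesgue ?P \<le> ?\<kappa> * measure lebesgue Q"
    using Q r by (simp only: Q(1) measure_cube measure_centered_cube) (simp add: power_mult_distrib)
  have "ennreal (t * norm x powr b * (U / (C * ?\<kappa>)) powr p)
      \<le> weighted_measure (\<lambda>y. g y * u y powr p) Q"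
    unfolding U_def using par C_pos s
    by (intro weighted_maximal_bound[OF u_pos u_measurable g cube_average_le[OF P] _ _ _ _ _ Qc sub \<kappa>]) auto
  then have "t * norm x powr b * (U / (C * ?\<kappa>)) powr p \<le> J"
    using J by simp
  then have "(norm x powr b) powr q * (U / (C * ?\<kappa>)) \<le> (J / t) powr q"
    using par C_pos by (intro powr_solve) (auto simp: U_def)
  \<comment> \<open>Only \<open>J powr (q - 1)\<close> is bounded through \<open>I\<close>, which
    uses \<open>1 \<le> q\<close>. The remaining factor \<open>J\<close> keeps the estimate linear
    in the integral over \<open>Q\<close>, so that it can be summed over disjoint cubes.\<close>
  also have "\<dots> = J powr (q - 1) * J / t powr q"
    using J par by (cases "J = 0") (auto simp: powr_divide powr_diff)
  also have "\<dots> \<le> I powr (q - 1) * J / t powr q"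
    using J par by (intro divide_right_mono mult_right_mono powr_mono2) auto
  finally have U: "norm x powr (b * q) * U \<le> C * ?\<kappa> * (I powr (q - 1) / t powr q) * J"
    using C_pos by (simp add: powr_powr pos_divide_le_eq mult_ac)
  have near: "norm x / 2 \<le> norm y" if "y \<in> cball x ?r" for y
    using that r norm_triangle_ineq2[of x y] by (simp add: dist_norm)
  have "weighted_measure (\<lambda>y. u y * norm y powr (b * q)) (cball x ?r)
      \<le> ennreal ((norm x / 2) powr (b * q)) * weighted_measure u (cball x ?r)"
    using near x par
    by (intro weighted_measure_mult_le u_measurable) (auto intro!: powr_mono2' mult_nonpos_nonneg)
  also have "weighted_measure u (cball x ?r) \<le> weighted_measure u ?P"
  proof (rule weighted_measure_mono, rule subsetI)
    fix y assume "y \<in> cball x ?r"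
    then show "y \<in> ?P"
      using component_le_norm_cart[of "y - x"] 
      by (auto simp: mem_centered_cube dist_norm norm_minus_commute intro: order_trans)
  qed
  also have "\<dots> = ennreal U" unfolding U_def by (rule weighted_measure_cube_eq[OF P])
  also have "ennreal ((norm x / 2) powr (b * q)) * ennreal U
      = ennreal (2 powr - (b * q) * (norm x powr (b * q) * U))"
    by (subst ennreal_mult'[symmetric]) (simp_all add: powr_divide powr_minus field_simps)
  also have "\<dots> \<le> ennreal (2 powr - (b * q) * (C * ?\<kappa> * (I powr (q - 1) / t powr q) * J))"
    by (intro ennreal_leI mult_left_mono U) auto
  also have "\<dots> = ennreal (2 powr - (b * q) * (C * ?\<kappa>) * (I powr (q - 1) / t powr q)) *
      weighted_measure (\<lambda>y. g y * u y powr p) Q"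
    unfolding J(1) using J(2) by (simp add: ennreal_mult''[symmetric] mult.assoc)
  finally show ?thesis by (simp add: mult_left_mono)
qed


section \<open>Measurable covers of the level set\<close>

text \<open>Here \<open>b\<close> plays the role of the product \<open>\<beta> * q\<close>. The
  cover is the complement of a ball about the origin, controlled by \<open>tail_bound\<close>;
  \<open>\<epsilon>\<close> keeps the infimum of the norms positive.\<close>

lemma large_part_cover:
  assumes b: "b < - real CARD('n)"
  shows "\<exists>K>0. \<forall>L d \<epsilon>. 0 < \<epsilon> \<longrightarrow> 0 \<le> d \<longrightarrow>
    (\<forall>x\<in>L. \<epsilon> \<le> norm x \<and> norm x powr b * mass (norm x) \<le> d) \<longrightarrow>
    (\<exists>B\<in>sets lebesgue. L \<subseteq> B \<and> weighted_measure (\<lambda>x. u x * norm x powr b) B \<le> ennreal (K * d))"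
proof -
  from tail_bound[OF b] obtain K where K: "0 < K" "\<And>s. 0 < s \<Longrightarrow>
      weighted_measure (\<lambda>x. u x * norm x powr b) {x. s \<le> norm x} \<le> ennreal (K * (s powr b * mass s))"
    by metis
  show ?thesis
  proof (intro exI[of _ "K * 2 powr - b"] conjI allI impI)
    show "0 < K * 2 powr - b" using K by simp
  next
    fix L :: "(real ^ 'n) set" and d \<epsilon> :: real
    assume "0 < \<epsilon>" "0 \<le> d" "\<forall>x\<in>L. \<epsilon> \<le> norm x \<and> norm x powr b * mass (norm x) \<le> d"
    then have *: "0 < \<epsilon>" "0 \<le> d" "\<And>x. x \<in> L \<Longrightarrow> \<epsilon> \<le> norm x"
      "\<And>x. x \<in> L \<Longrightarrow> norm x powr b * mass (norm x) \<le> d"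
      by auto
    show "\<exists>B\<in>sets lebesgue. L \<subseteq> B \<and>
        weighted_measure (\<lambda>x. u x * norm x powr b) B \<le> ennreal (K * 2 powr - b * d)"
    proof (cases "L = {}")
      case True
      then show ?thesis by (intro bexI[of _ "{}"]) (auto simp: weighted_measure_def)
    next
      case False
      define s where "s = Inf (norm ` L)"
      have bdd: "bdd_below (norm ` L)" by (rule bdd_belowI[of _ 0]) auto
      have "\<epsilon> \<le> s" unfolding s_def using False *(3) by (intro cInf_greatest) auto
      then have "s < 2 * s" using *(1) by simp
      then obtain x where x: "x \<in> L" "norm x < 2 * s"
        unfolding s_def using cInf_lessD[of "norm ` L"] False by blast
      \<comment> \<open>The infimum may not be attained, so a point within a factor 2 of it is used.
        Halving its norm gives a radius below all norms in \<open>L\<close>; this does not increase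
        the mass and costs the factor \<open>2 powr - b\<close>.\<close>
      define r where "r = norm x / 2"
      have r: "0 < r" "r \<le> s" using x *(1) *(3)[OF x(1)] by (auto simp: r_def)
      have sub: "L \<subseteq> {y. r \<le> norm y}"
      proof
        fix y assume "y \<in> L"
        then have "s \<le> norm y" unfolding s_def using bdd by (intro cInf_lower) auto
        with r show "y \<in> {y. r \<le> norm y}" by simp
      qed
      have "closed {y :: real ^ 'n. r \<le> norm y}" by (intro closed_Collect_le continuous_intros)
      then have m: "{y :: real ^ 'n. r \<le> norm y} \<in> sets lebesgue"
        by (rule lebesgue_closedin[of UNIV, simplified])
      have "K * (r powr b * mass r) \<le> K * (r powr b * mass (norm x))"
        using K r by (intro mult_left_mono mass_mono) (auto simp: r_def)
      also have "\<dots> = K * 2 powr - b * (norm x powr b * mass (norm x))"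
        by (simp add: r_def powr_divide powr_minus field_simps)
      also have "\<dots> \<le> K * 2 powr - b * d"
        using K *(4)[OF x(1)] by (intro mult_left_mono) auto
      finally have "ennreal (K * (r powr b * mass r)) \<le> ennreal (K * 2 powr - b * d)"
        by (rule ennreal_leI)
      with K(2)[OF r(1)] have "weighted_measure (\<lambda>x. u x * norm x powr b) {y. r \<le> norm y}
          \<le> ennreal (K * 2 powr - b * d)"
        by (rule order_trans)
      with sub m show ?thesis by (intro bexI[of _ "{y. r \<le> norm y}"]) auto
    qed
  qed
qed

text \<open>Vitali's lemma is applied to balls containing the witnessing cubes; \<open>R\<close>
  bounds their radii. Disjointness passes from the selected balls to their cubes, so the local
  integrals add up to at most \<open>I\<close>, while the fivefold balls cover
  \<open>S\<close>.\<close>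

lemma small_part_cover:
  fixes g :: "real ^ 'n \<Rightarrow> real"
  assumes g: "g \<in> borel_measurable lebesgue" "\<And>x. 0 \<le> g x"
    and par: "0 < t" "0 < p" "p * q = 1" "1 \<le> q" "b < 0" "0 \<le> I"
    and I: "(\<integral>\<^sup>+y. ennreal (g y * u y powr p) \<partial>lebesgue) \<le> ennreal I"
    and S: "\<And>x. x \<in> S \<Longrightarrow> norm x \<le> R"
      "\<And>x. x \<in> S \<Longrightarrow> \<exists>a l. 0 < l \<and> x \<in> cbox a (\<chi> i. a $ i + l) \<and> 10 * real CARD('n) * l \<le> norm x \<and>
        ennreal (t * norm x powr b) \<le> ennreal (measure lebesgue (cbox a (\<chi> i. a $ i + l)) powr - p) *
          weighted_measure g (cbox a (\<chi> i. a $ i + l))"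
  obtains B where "B \<in> sets lebesgue" "S \<subseteq> B"
    "weighted_measure (\<lambda>x. u x * norm x powr (b * q)) B
      \<le> ennreal (2 powr - (b * q) * (C * (10 * real CARD('n)) ^ CARD('n)) * (I / t) powr q)"
proof -
  let ?w = "\<lambda>x. u x * norm x powr (b * q)" and ?h = "\<lambda>y. g y * u y powr p"
  let ?k = "2 powr - (b * q) * (C * (10 * real CARD('n)) ^ CARD('n))"
  let ?K = "?k * (I powr (q - 1) / t powr q)"
  have h: "?h \<in> borel_measurable lebesgue" using g(1) by measurable
  obtain a l where al: "\<And>x. x \<in> S \<Longrightarrow> 0 < l x \<and> x \<in> cbox (a x) (\<chi> i. a x $ i + l x) \<and>
      10 * real CARD('n) * l x \<le> norm x \<and>
      ennreal (t * norm x powr b) \<le> ennreal (measure lebesgue (cbox (a x) (\<chi> i. a x $ i + l x)) powr - p) *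
        weighted_measure g (cbox (a x) (\<chi> i. a x $ i + l x))"
    using S(2) by metis
  define Q where "Q x = cbox (a x) (\<chi> i. a x $ i + l x)" for x
  define r where "r x = real CARD('n) * l x" for x
  have r: "0 < r x \<and> r x \<le> R" if "x \<in> S" for x
  proof -
    have "0 < r x" using al[OF that] by (simp add: r_def)
    moreover have "10 * r x \<le> R" using al[OF that] S(1)[OF that] by (simp add: r_def)
    ultimately show ?thesis by simp
  qed
  have cov: "S \<subseteq> (\<Union>x\<in>S. cball x (r x))" using r by force
  obtain T where T: "countable T" "T \<subseteq> S"
    "pairwise (\<lambda>i j. disjnt (cball i (r i)) (cball j (r j))) T" "S \<subseteq> (\<Union>i\<in>T. cball i (5 * r i))"
    by (rule Vitali_covering_lemma_cballs[OF cov r])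
  have Qsub: "Q x \<subseteq> cball x (r x)" if "x \<in> S" for x
    unfolding Q_def r_def using al[OF that] by (intro cube_subset_cball) simp
  have disj: "disjoint_family_on Q T"
    unfolding disjoint_family_on_def
  proof (intro ballI impI)
    fix i j assume ij: "i \<in> T" "j \<in> T" "i \<noteq> j"
    then have "disjnt (cball i (r i)) (cball j (r j))" using T(3) by (auto simp: pairwise_def)
    moreover have "Q i \<subseteq> cball i (r i)" "Q j \<subseteq> cball j (r j)" using ij T(2) Qsub by auto
    ultimately show "Q i \<inter> Q j = {}" by (auto simp: disjnt_def)
  qed
  have each: "weighted_measure ?w (cball x (5 * r x)) \<le> ennreal ?K * weighted_measure ?h (Q x)"
    if "x \<in> T" for x
  proof -
    have x: "x \<in> S" using that T(2) by auto
    have "weighted_measure ?h (Q x) \<le> (\<integral>\<^sup>+y. ennreal (?h y) \<partial>lebesgue)"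
      unfolding weighted_measure_def by (intro nn_integral_mono) (auto simp: indicator_def)
    then have "weighted_measure ?h (Q x) \<le> ennreal I" using I by (rule order_trans)
    then show ?thesis
      unfolding r_def using al[OF x] par g Q_def
      by (intro small_cube_bound[where a = "a x"]) auto
  qed
  have "weighted_measure ?w (\<Union>i\<in>T. cball i (5 * r i))
      \<le> (\<integral>\<^sup>+i. weighted_measure ?w (cball i (5 * r i)) \<partial>count_space T)"
    by (intro weighted_measure_UN_le weighted_power_measurable T) auto
  also have "\<dots> \<le> (\<integral>\<^sup>+i. ennreal ?K * weighted_measure ?h (Q i) \<partial>count_space T)"
    by (intro nn_integral_mono each) simp
  also have "\<dots> = ennreal ?K * (\<integral>\<^sup>+i. weighted_measure ?h (Q i) \<partial>count_space T)"
    by (intro nn_integral_cmult) simp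
  also have "\<dots> \<le> ennreal ?K * ennreal I"
    using sum_weighted_measure_disjoint_le[OF h T(1) _ disj] I
    by (intro mult_left_mono) (auto simp: Q_def intro: order_trans)
  \<comment> \<open>The powers of \<open>I\<close> and \<open>t\<close> combine to
    \<open>(I / t) powr q\<close>. The case \<open>I = 0\<close> is separate because the power rule
    introduces a division by \<open>I\<close>.\<close>
  also have "\<dots> = ennreal (?k * (I / t) powr q)"
    using par C_pos by (cases "I = 0") (auto simp: ennreal_mult''[symmetric] powr_divide powr_diff)
  finally show thesis using T by (intro that[of "\<Union>i\<in>T. cball i (5 * r i)"]) auto
qed

text \<open>Points with a witnessing cube of side at most
  \<open>norm x / (10 * real CARD('n))\<close> are covered by \<open>small_part_cover\<close>. At
  every other point all witnessing cubes are longer, and \<open>large_cube_bound\<close> feeds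
  \<open>large_part_cover\<close>.\<close>

lemma weak_type_power_weight:
  assumes par: "0 < p" "p * q = 1" "1 \<le> q" "b * q < - real CARD('n)"
  shows "\<exists>K>0. \<forall>g t I. g \<in> borel_measurable lebesgue \<longrightarrow> (\<forall>x. 0 \<le> g x) \<longrightarrow> 0 < t \<longrightarrow> 0 \<le> I \<longrightarrow>
      (\<integral>\<^sup>+y. ennreal (g y * u y powr p) \<partial>lebesgue) \<le> ennreal I \<longrightarrow>
    weighted_measure (\<lambda>x. u x * norm x powr (b * q))
      {x. x \<noteq> 0 \<and> (\<exists>Q\<in>cubes. x \<in> Q \<and>
        ennreal (t * norm x powr b) \<le> ennreal (measure lebesgue Q powr - p) * weighted_measure g Q)}
      \<le> ennreal (K * (I / t) powr q)"
proof -
  let ?w = "\<lambda>x. u x * norm x powr (b * q)"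
  let ?c = "1 / (10 * real CARD('n))"
  define k1 where "k1 = 2 powr - (b * q) * (C * (10 * real CARD('n)) ^ CARD('n))"
  define k2 where "k2 = C * (2 * (1 / ?c + 1)) ^ CARD('n)"
  have "b * q < 0" using par(4) by (rule less_le_trans) simp
  then have b: "b < 0" using par(3) by (simp add: mult_less_0_iff)
  have k: "0 < k1" "0 < k2"
    unfolding k1_def k2_def using C_pos by (auto intro!: mult_pos_pos zero_less_power add_pos_pos)
  obtain K where K: "0 < K"
    "\<And>L d \<epsilon>. 0 < \<epsilon> \<Longrightarrow> 0 \<le> d \<Longrightarrow>
        \<forall>x\<in>L. \<epsilon> \<le> norm x \<and> norm x powr (b * q) * mass (norm x) \<le> d \<Longrightarrow>
      \<exists>B\<in>sets lebesgue. L \<subseteq> B \<and> weighted_measure ?w B \<le> ennreal (K * d)"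
    using large_part_cover[OF par(4)] by blast
  show ?thesis
  proof (intro exI[of _ "k1 + K * k2"] conjI allI impI)
    show "0 < k1 + K * k2" using k K(1) by (intro add_pos_pos mult_pos_pos)
  next
    fix g :: "real ^ 'n \<Rightarrow> real" and t I :: real
    assume "g \<in> borel_measurable lebesgue" "\<forall>x. 0 \<le> g x" and t: "0 < t" "0 \<le> I"
      and I: "(\<integral>\<^sup>+y. ennreal (g y * u y powr p) \<partial>lebesgue) \<le> ennreal I"
    then have g: "g \<in> borel_measurable lebesgue" "\<And>x. 0 \<le> g x" by auto
    define G where "G x Q \<longleftrightarrow> x \<in> Q \<and>
      ennreal (t * norm x powr b) \<le> ennreal (measure lebesgue Q powr - p) * weighted_measure g Q" for x Q
    define E where "E = {x. x \<noteq> 0 \<and> (\<exists>Q\<in>cubes. G x Q)}"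
    \<comment> \<open>The truncation supplies the outer radius required by
      \<open>small_part_cover\<close> and the positive lower bound required by
      \<open>large_part_cover\<close>. The resulting estimate is independent of
      \<open>N\<close>.\<close>
    define E' where "E' N = E \<inter> {x. 1 / real (Suc N) \<le> norm x \<and> norm x \<le> real (Suc N)}" for N
    have "\<exists>B\<in>sets lebesgue. E' N \<subseteq> B \<and> weighted_measure ?w B \<le> ennreal ((k1 + K * k2) * (I / t) powr q)" for N
    proof -
      define S where "S = {x \<in> E' N. \<exists>a l. 0 < l \<and> 10 * real CARD('n) * l \<le> norm x \<and>
        G x (cbox a (\<chi> i. a $ i + l))}"
      have "\<exists>a l. 0 < l \<and> x \<in> cbox a (\<chi> i. a $ i + l) \<and> 10 * real CARD('n) * l \<le> norm x \<and>
        ennreal (t * norm x powr b) \<le> ennreal (measure lebesgue (cbox a (\<chi> i. a $ i + l)) powr - p) *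
          weighted_measure g (cbox a (\<chi> i. a $ i + l))" if "x \<in> S" for x
        using that unfolding S_def G_def by blast
      moreover have "norm x \<le> real (Suc N)" if "x \<in> S" for x
        using that by (auto simp: S_def E'_def)
      ultimately obtain B1 where B1: "B1 \<in> sets lebesgue" "S \<subseteq> B1"
        "weighted_measure ?w B1 \<le> ennreal (k1 * (I / t) powr q)"
        using small_part_cover[OF g t(1) par(1,2,3) b t(2) I, of S "real (Suc N)"] unfolding k1_def by blast
      have "norm x powr (b * q) * mass (norm x) \<le> k2 * (I / t) powr q" if x: "x \<in> E' N - S" for x
      proof -
        from x obtain Q where Q: "Q \<in> cubes" "G x Q" and x0: "x \<noteq> 0" by (auto simp: E'_def E_def)
        then obtain a l where l: "Q = cbox a (\<chi> i. a $ i + l)" "0 < l" by (auto simp: cubes_def)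
        have "\<not> 10 * real CARD('n) * l \<le> norm x" using x l Q(2) unfolding S_def by blast
        then have "?c * norm x \<le> l" by (simp add: field_simps)
        moreover have "weighted_measure (\<lambda>y. g y * u y powr p) Q \<le> ennreal I"
        proof -
          have "weighted_measure (\<lambda>y. g y * u y powr p) Q \<le> (\<integral>\<^sup>+y. ennreal (g y * u y powr p) \<partial>lebesgue)"
            unfolding weighted_measure_def by (intro nn_integral_mono) (auto simp: indicator_def)
          then show ?thesis using I by (rule order_trans)
        qed
        ultimately show ?thesis
          using Q(2) l x0 par t g unfolding G_def k2_def by (intro large_cube_bound) auto
      qed
      moreover have "1 / real (Suc N) \<le> norm x" if "x \<in> E' N - S" for x
        using that by (auto simp: E'_def)
      ultimately have "\<forall>x\<in>E' N - S. 1 / real (Suc N) \<le> norm x \<and>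
          norm x powr (b * q) * mass (norm x) \<le> k2 * (I / t) powr q"
        by blast
      from K(2)[OF _ _ this] k(2) obtain B2 where B2: "B2 \<in> sets lebesgue" "E' N - S \<subseteq> B2"
        "weighted_measure ?w B2 \<le> ennreal (K * (k2 * (I / t) powr q))"
        by (auto simp del: of_nat_Suc)
      \<comment> \<open>Subadditivity is available for the measurable covers; the measurability of
        \<open>S\<close> and of \<open>E' N - S\<close> is not established.\<close>
      have "weighted_measure ?w (B1 \<union> B2) \<le> weighted_measure ?w B1 + weighted_measure ?w B2"
        using B1(1) B2(1) weighted_power_measurable
        by (simp add: weighted_measure_eq_emeasure emeasure_subadditive)
      also have "\<dots> \<le> ennreal (k1 * (I / t) powr q) + ennreal (K * (k2 * (I / t) powr q))"
        by (intro add_mono B1 B2)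
      also have "\<dots> = ennreal ((k1 + K * k2) * (I / t) powr q)"
        using k K(1) by (simp add: ennreal_plus[symmetric] distrib_right mult.assoc del: ennreal_plus)
      finally show ?thesis using B1 B2 by (intro bexI[of _ "B1 \<union> B2"]) auto
    qed
    then obtain B where B: "\<And>N. B N \<in> sets lebesgue" "\<And>N. E' N \<subseteq> B N"
      "\<And>N. weighted_measure ?w (B N) \<le> ennreal ((k1 + K * k2) * (I / t) powr q)"
      by metis
    have inc: "incseq E'"
    proof (rule incseq_SucI)
      fix N
      have "1 / real (Suc (Suc N)) \<le> 1 / real (Suc N)" by (intro divide_left_mono) auto
      then show "E' N \<subseteq> E' (Suc N)" by (auto simp: E'_def simp del: of_nat_Suc)
    qed
    have "E \<subseteq> (\<Union>N. E' N)"
    proof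
      fix x assume x: "x \<in> E"
      then have "0 < norm x" by (simp add: E_def)
      then obtain N1 where N1: "inverse (real (Suc N1)) < norm x" using reals_Archimedean by blast
      obtain N2 where N2: "norm x < real N2" using reals_Archimedean2 by blast
      have "x \<in> E' (max N1 N2)"
      proof -
        have "1 / real (Suc (max N1 N2)) \<le> 1 / real (Suc N1)" by (intro divide_left_mono) auto
        then show ?thesis using x N1 N2
          by (auto simp: E'_def inverse_eq_divide simp del: of_nat_Suc)
      qed
      then show "x \<in> (\<Union>N. E' N)" by blast
    qed
    then have "weighted_measure ?w E \<le> weighted_measure ?w (\<Union>N. E' N)"
      by (rule weighted_measure_mono)
    also have "\<dots> \<le> ennreal ((k1 + K * k2) * (I / t) powr q)"
      by (rule weighted_measure_UN_incseq_le[OF weighted_power_measurable inc B(2,1,3)])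
    finally show "weighted_measure ?w {x. x \<noteq> 0 \<and> (\<exists>Q\<in>cubes. x \<in> Q \<and>
        ennreal (t * norm x powr b) \<le> ennreal (measure lebesgue Q powr - p) * weighted_measure g Q)}
      \<le> ennreal ((k1 + K * k2) * (I / t) powr q)"
      by (simp only: E_def G_def)
  qed
qed

end

section \<open>From the maximal operator to the weak type inequality\<close>

text \<open>A value strictly below a supremum is exceeded by one of its members, which yields the
  cube. The exponents \<open>\<gamma> / real CARD('n)\<close> and -1 of its volume add up to
  \<open>- p\<close>.\<close>

lemma fractional_maximal_div_exceeds:
  fixes f :: "real ^ 'n \<Rightarrow> real"
  assumes "0 < c" "0 < t" and ex: "ennreal t < fractional_maximal \<gamma> f x / ennreal c"
    and p: "p = 1 - \<gamma> / real CARD('n)"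
  shows "\<exists>Q\<in>cubes. x \<in> Q \<and>
    ennreal (t * c) \<le> ennreal (measure lebesgue Q powr - p) * weighted_measure (\<lambda>y. \<bar>f y\<bar>) Q"
proof -
  have "ennreal t * ennreal c < fractional_maximal \<gamma> f x"
  proof (rule ccontr)
    assume "\<not> ?thesis"
    then have "fractional_maximal \<gamma> f x / ennreal c \<le> ennreal t * ennreal c / ennreal c"
      by (intro divide_right_mono_ennreal) simp
    also have "\<dots> = ennreal t" using assms by (simp add: ennreal_mult'[symmetric] divide_ennreal)
    finally show False using ex by simp
  qed
  then obtain Q where Q: "Q \<in> cubes" "x \<in> Q" and
    lt: "ennreal t * ennreal c < ennreal (measure lebesgue Q powr (\<gamma> / real CARD('n))) *
      (ennreal (1 / measure lebesgue Q) * (\<integral>\<^sup>+y\<in>Q. ennreal \<bar>f y\<bar> \<partial>lebesgue))"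
    unfolding fractional_maximal_def less_SUP_iff by blast
  have "measure lebesgue Q powr (\<gamma> / real CARD('n)) * (1 / measure lebesgue Q)
      = measure lebesgue Q powr - p"
    using measure_cubes_pos[OF Q(1)] by (simp add: p powr_diff)
  then have "ennreal (measure lebesgue Q powr - p) =
      ennreal (measure lebesgue Q powr (\<gamma> / real CARD('n))) * ennreal (1 / measure lebesgue Q)"
    by (metis ennreal_mult' powr_ge_zero)
  with lt have "ennreal (t * c) \<le> ennreal (measure lebesgue Q powr - p) * weighted_measure (\<lambda>y. \<bar>f y\<bar>) Q"
    using assms by (simp add: weighted_measure_def ennreal_mult' mult.assoc)
  with Q show ?thesis by blast
qed

text \<open>A single point is Lebesgue null. This discards the origin from the level set.\<close>

lemma weighted_measure_insert:
  "weighted_measure w (insert a A) = weighted_measure w A"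
  unfolding weighted_measure_def
proof (rule nn_integral_cong_AE)
  have "{a} \<in> null_sets lebesgue" by simp
  then have "AE x in lebesgue. x \<notin> {a}" by (rule AE_not_in)
  then show "AE x in lebesgue. ennreal (w x) * indicator (insert a A) x = ennreal (w x) * indicator A x"
    by eventually_elim (simp add: indicator_def)
qed

lemma ennreal_powr_inverse_le:
  assumes "x \<le> ennreal (K * z powr q)" "0 < K" "0 \<le> z" "0 < q"
  shows "ennreal_powr x (1 / q) \<le> ennreal (K powr (1 / q) * z)"
proof -
  have "x \<noteq> top" using assms(1) by (auto simp: top_unique)
  then obtain y where y: "x = ennreal y" "0 \<le> y" by (cases x) auto
  then have "y \<le> K * z powr q" using assms by simp
  then have "y powr (1 / q) \<le> (K * z powr q) powr (1 / q)" using y assms by (intro powr_mono2) auto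
  also have "\<dots> = K powr (1 / q) * z" using assms by (simp add: powr_mult powr_powr)
  finally show ?thesis using y by (simp add: ennreal_powr_def ennreal_leI)
qed

theorem corollary7:
  fixes \<gamma> \<beta> q :: real and u v :: "real ^ 'n \<Rightarrow> real"
  assumes "0 < \<gamma>" and "\<gamma> < real CARD('n)"
    and "A1_weight u"
    and "\<beta> < - real CARD('n)"
    and "v = (\<lambda>x. norm x powr \<beta>)"
    and "q = real CARD('n) / (real CARD('n) - \<gamma>)"
  shows "\<exists>C>0. \<forall>t>0. \<forall>f :: real ^ 'n \<Rightarrow> real.
           f \<in> borel_measurable lebesgue \<longrightarrow> bounded (range f) \<longrightarrow>
           ennreal_powr
             (weighted_measure (\<lambda>x. u x * v x powr q)
                {x. fractional_maximal \<gamma> (\<lambda>y. f y * v y) x / ennreal (v x) > ennreal t})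
             (1 / q)
           \<le> ennreal (C / t) * (\<integral>\<^sup>+x. ennreal (\<bar>f x\<bar> * u x powr (1 / q) * v x) \<partial>lebesgue)"
proof -
  have "weight u" using assms(3) by (simp add: A1_weight_def)
  obtain A where "0 < A" "\<And>Q. Q \<in> cubes \<Longrightarrow> AE x in lebesgue. x \<in> Q \<longrightarrow>
       enn2real (weighted_measure u Q) \<le> A * measure lebesgue Q * u x"
    by (rule A1_weight_AE[OF assms(3)]) blast
  with \<open>weight u\<close> interpret A1_bound u A by unfold_locales
  let ?p = "1 / q"
  have q: "1 \<le> q" unfolding assms(6) using assms(1,2) by (subst le_divide_eq_1_pos) auto
  have p: "?p = 1 - \<gamma> / real CARD('n)" using assms(2) by (simp add: assms(6) field_simps)
  \<comment> \<open>As \<open>\<beta>\<close> is negative and \<open>q\<close> at least 1, the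
    exponent \<open>\<beta> * q\<close> inherits the decay that makes the dyadic series
    converge.\<close>
  have "\<beta> * q \<le> \<beta> * 1" using q assms(4) by (intro mult_left_mono_neg) auto
  then have bq: "\<beta> * q < - real CARD('n)" using assms(4) by linarith
  have v: "v \<in> borel_measurable lebesgue"
    unfolding assms(5) by (intro measurable_completion) simp
  have vq: "v x powr q = norm x powr (\<beta> * q)" for x by (simp add: assms(5) powr_powr)
  have pp: "0 < ?p" "?p * q = 1" using q by auto
  obtain K where K: "0 < K" "\<And>g t I. g \<in> borel_measurable lebesgue \<Longrightarrow> \<forall>x. 0 \<le> g x \<Longrightarrow> 0 < t \<Longrightarrow> 0 \<le> I \<Longrightarrow>
      (\<integral>\<^sup>+y. ennreal (g y * u y powr ?p) \<partial>lebesgue) \<le> ennreal I \<Longrightarrow>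
    weighted_measure (\<lambda>x. u x * norm x powr (\<beta> * q))
      {x. x \<noteq> 0 \<and> (\<exists>Q\<in>cubes. x \<in> Q \<and>
        ennreal (t * norm x powr \<beta>) \<le> ennreal (measure lebesgue Q powr - ?p) * weighted_measure g Q)}
      \<le> ennreal (K * (I / t) powr q)"
    using weak_type_power_weight[OF pp q bq] by blast
  show ?thesis
  \<comment> \<open>The constant appears on taking the \<open>q\<close>-th root of
    \<open>K * (I / t) powr q\<close>.\<close>
  proof (intro exI[of _ "K powr ?p"] conjI allI impI)
    show "0 < K powr ?p" using K(1) by simp
  next
    fix t :: real and f :: "real ^ 'n \<Rightarrow> real"
    assume t: "0 < t" and f: "f \<in> borel_measurable lebesgue"
    define J where "J = (\<integral>\<^sup>+x. ennreal (\<bar>f x\<bar> * u x powr ?p * v x) \<partial>lebesgue)"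
    let ?E = "{x. fractional_maximal \<gamma> (\<lambda>y. f y * v y) x / ennreal (v x) > ennreal t}"
    let ?g = "\<lambda>y. \<bar>f y * v y\<bar>"
    show "ennreal_powr (weighted_measure (\<lambda>x. u x * v x powr q) ?E) ?p \<le> ennreal (K powr ?p / t) *
        (\<integral>\<^sup>+x. ennreal (\<bar>f x\<bar> * u x powr ?p * v x) \<partial>lebesgue)"
    proof (cases "J = top")
      case True
      \<comment> \<open>A positive constant times infinity is infinite, so the right-hand side is
        \<open>top\<close>.\<close>
      then show ?thesis using K(1) t by (simp add: J_def[symmetric] ennreal_mult_top)
    next
      case False
      define I where "I = enn2real J"
      have I: "J = ennreal I" "0 \<le> I" using False by (auto simp: I_def less_top)
      have gJ: "(\<integral>\<^sup>+y. ennreal (?g y * u y powr ?p) \<partial>lebesgue) \<le> ennreal I"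
        unfolding I(1)[symmetric] J_def by (simp add: assms(5) abs_mult mult_ac)
      let ?F = "{x. x \<noteq> 0 \<and> (\<exists>Q\<in>cubes. x \<in> Q \<and>
        ennreal (t * norm x powr \<beta>) \<le> ennreal (measure lebesgue Q powr - ?p) * weighted_measure ?g Q)}"
      \<comment> \<open>The origin may belong to \<open>?E\<close> because \<open>v 0 = 0 powr \<beta> = 0\<close>.\<close>
      have "?E \<subseteq> insert 0 ?F"
      proof
        fix x assume x: "x \<in> ?E"
        show "x \<in> insert 0 ?F"
        proof (cases "x = 0")
          case False
          with x fractional_maximal_div_exceeds[of "v x" t \<gamma> "\<lambda>y. f y * v y" x ?p] p t
          show ?thesis by (simp add: assms(5))
        qed simp
      qed
      then have "weighted_measure (\<lambda>x. u x * v x powr q) ?E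
          \<le> weighted_measure (\<lambda>x. u x * v x powr q) (insert 0 ?F)"
        by (rule weighted_measure_mono)
      also have "\<dots> = weighted_measure (\<lambda>x. u x * norm x powr (\<beta> * q)) ?F"
        by (simp only: weighted_measure_insert vq)
      also have "\<dots> \<le> ennreal (K * (I / t) powr q)"
        using f v t I(2) gJ by (intro K(2)) auto
      finally have "ennreal_powr (weighted_measure (\<lambda>x. u x * v x powr q) ?E) ?p
          \<le> ennreal (K powr ?p * (I / t))"
        using K(1) I(2) t q by (intro ennreal_powr_inverse_le) auto
      also have "\<dots> = ennreal (K powr ?p / t) * J"
        unfolding I(1) using I(2) by (simp add: ennreal_mult''[symmetric])
      finally show ?thesis by (simp only: J_def)
    qed
  qed
qed

end
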